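(* Let $A$ be an ordered commutative monoid with generating pair $(g_+,g_-)$. For every functional $f:A\to\mathbb{R}$ there exists a regular Borel measure $\mu$ on $\overline{\mathrm{ex}}(A,g_+,g_-)$ such that for all $x\in A$ $$f(x)=\int\hat f(x)\,\mathrm{d}\mu(\hat f).$$
   Context: An ordered commutative monoid is a set $A$ with a partial order $\geq$ and a commutative monoid structure $(+,0)$ such that $x\geq y$ implies $x+z\geq y+z$. A functional on $A$ is a map $f:A\to\mathbb{R}$ with $x\geq y\Rightarrow f(x)\geq f(y)$, $f(x+y)=f(x)+f(y)$, $f(0)=0$. A generating pair is a pair $g_+,g_-\in A$ with $g_+\geq g_-$ such that for every $x\in A$ there is $n\in\mathbb{N}$ with $ng_+\geq x+ng_-$ and $ng_++x\geq ng_-$. A functional $f$ is normalized if $f(g_+)=f(g_-)+1$. For functionals $f,f'$ write $f\geq f'$ if $f-f'$ is itself a functional. A functional $f$ is extremal if for every functional $f'$ with $f\geq f'$ there is a constant $\lambda\in\mathbb{R}_{\geq0}$ with $f'=\lambda f$. The set of normalized functionals carries the weak-* topology, i.e. the weakest topology making all evaluation maps $f\mapsto f(x)$ ($x\in A$) continuous. $\overline{\mathrm{ex}}(A,g_+,g_-)$ is the closure, in this topology, of the set of normalized extremal functionals, with the subspace topology. Measures are nonnegative. *)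

theory Defs
  imports "HOL-Analysis.Analysis"
begin

text \<open>
  The ordered commutative monoid is the universe of a type of class
  \<^class>\<open>ordered_comm_monoid_add\<close>; its order is a partial order and no
  cancellation or positivity is assumed.
\<close>

definition nat_multiple :: "nat \<Rightarrow> 'a::comm_monoid_add \<Rightarrow> 'a" where
  "nat_multiple n x = (\<Sum>i<n. x)"

definition functional :: "('a::ordered_comm_monoid_add \<Rightarrow> real) \<Rightarrow> bool" where
  "functional f \<longleftrightarrow> mono f \<and> (\<forall>x y. f (x + y) = f x + f y) \<and> f 0 = 0"

definition generating_pair :: "'a::ordered_comm_monoid_add \<Rightarrow> 'a \<Rightarrow> bool" where
  "generating_pair gp gm \<longleftrightarrow>
     gp \<ge> gm \<and>
     (\<forall>x. \<exists>n. nat_multiple n gp \<ge> x + nat_multiple n gm \<and>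
               nat_multiple n gp + x \<ge> nat_multiple n gm)"

text \<open>This is not the pointwise order: the difference has to be monotone as well.\<close>

definition functional_ge ::
  "('a::ordered_comm_monoid_add \<Rightarrow> real) \<Rightarrow> ('a \<Rightarrow> real) \<Rightarrow> bool" where
  "functional_ge f f' \<longleftrightarrow> functional (\<lambda>x. f x - f' x)"

definition extremal :: "('a::ordered_comm_monoid_add \<Rightarrow> real) \<Rightarrow> bool" where
  "extremal f \<longleftrightarrow> functional f \<and>
     (\<forall>f'. functional f' \<and> functional_ge f f' \<longrightarrow> (\<exists>c\<ge>0. \<forall>x. f' x = c * f x))"

definition normalized_functionals ::
  "'a::ordered_comm_monoid_add \<Rightarrow> 'a \<Rightarrow> ('a \<Rightarrow> real) set" where
  "normalized_functionals gp gm = {f. functional f \<and> f gp = f gm + 1}"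

definition weak_star_topology ::
  "'a::ordered_comm_monoid_add \<Rightarrow> 'a \<Rightarrow> ('a \<Rightarrow> real) topology" where
  "weak_star_topology gp gm =
     topology_generated_by {{f \<in> normalized_functionals gp gm. f x \<in> U} | x U. open U}"

definition ex_closure ::
  "'a::ordered_comm_monoid_add \<Rightarrow> 'a \<Rightarrow> ('a \<Rightarrow> real) set" where
  "ex_closure gp gm =
     weak_star_topology gp gm closure_of {f \<in> normalized_functionals gp gm. extremal f}"

definition ex_closure_topology ::
  "'a::ordered_comm_monoid_add \<Rightarrow> 'a \<Rightarrow> ('a \<Rightarrow> real) topology" where
  "ex_closure_topology gp gm = subtopology (weak_star_topology gp gm) (ex_closure gp gm)"

text \<open>
  Conventions on regularity vary; this one asks for finiteness on compact sets and
  for outer and inner regularity on all Borel sets.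
\<close>

definition regular_borel_measure :: "'b topology \<Rightarrow> 'b measure \<Rightarrow> bool" where
  "regular_borel_measure T M \<longleftrightarrow>
     space M = topspace T \<and>
     sets M = sigma_sets (topspace T) {U. openin T U} \<and>
     (\<forall>K. K \<in> sets M \<and> compactin T K \<longrightarrow> emeasure M K < \<infinity>) \<and>
     (\<forall>B\<in>sets M. emeasure M B = (INF U\<in>{U. openin T U \<and> B \<subseteq> U}. emeasure M U)) \<and>
     (\<forall>B\<in>sets M. emeasure M B =
        (SUP K\<in>{K. K \<in> sets M \<and> compactin T K \<and> K \<subseteq> B}. emeasure M K))"

end

theory Submission
  imports Defs "HOL-Library.Function_Algebras"
begin

text \<open>
  The normalized functionals form a compact convex set: the generating pair bounds all of them
  uniformly at each element, so Tychonoff's theorem applies. Let \<open>X\<close> be the closure of the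
  normalized extremal ones and put \<open>c = f gp - f gm\<close>, the mass that a representing measure must
  have because every \<open>h \<in> X\<close> satisfies \<open>h gp - h gm = 1\<close>.

  The geometric input is Bauer's maximum principle (\<open>extremal_maximizer\<close>): the difference of
  two evaluations attains its maximum over the normalized functionals at an extremal one. Hence an
  inequality \<open>h x \<le> h y + t\<close> that holds for all \<open>h \<in> X\<close> forces \<open>f x \<le> f y + t * c\<close>
  (\<open>functional_dominated\<close>). Thus the assignment
  \<open>(h \<mapsto> (h x - h y) / n + t) \<mapsto> (f x - f y) / n + t * c\<close> is well defined and monotone on these
  functions on \<open>X\<close>, and a Hahn--Banach argument extends it to an additive, monotone functional \<open>L\<close>
  on all bounded functions on \<open>X\<close> (\<open>positive_extension\<close>).

  It remains to represent \<open>L\<close> by a measure on continuous functions. Applied to indicators, \<open>L\<close> is a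
  finitely additive set function on all subsets of \<open>X\<close>. Its regularization, from inside by closed
  and then from outside by open sets, is a regular Borel measure \<open>\<mu>\<close> of the same total mass that is
  at least as large as \<open>L\<close> on closed sets (\<open>regular_measure\<close>). Decomposing a continuous function
  into its superlevel sets, which are closed, gives \<open>L g \<le> \<integral> g d\<mu>\<close>, and the same for \<open>-g\<close> gives
  equality (\<open>representing_measure\<close>). Evaluations are continuous on \<open>X\<close>, so
  \<open>f x = L (h \<mapsto> h x) = \<integral> h x d\<mu>(h)\<close>.
\<close>

section \<open>Natural multiples\<close>

lemma nat_multiple_0 [simp]: "nat_multiple 0 x = 0"
  and nat_multiple_Suc: "nat_multiple (Suc n) x = nat_multiple n x + x"
  by (simp_all add: nat_multiple_def)

lemma nat_multiple_1 [simp]: "nat_multiple (Suc 0) x = x"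
  by (simp add: nat_multiple_Suc)

lemma nat_multiple_add: "nat_multiple (m + n) x = nat_multiple m x + nat_multiple n x"
  by (induction n) (simp_all add: nat_multiple_Suc add.assoc)

lemma nat_multiple_plus: "nat_multiple n (x + y) = nat_multiple n x + nat_multiple n y"
  by (simp add: nat_multiple_def sum.distrib)

lemma nat_multiple_mult: "nat_multiple (m * n) x = nat_multiple m (nat_multiple n x)"
  by (induction m) (simp_all add: nat_multiple_Suc nat_multiple_add add.commute)

lemma nat_multiple_fun: "nat_multiple n g x = real n * g x" for g :: "'b \<Rightarrow> real"
  by (induction n) (simp_all add: nat_multiple_Suc algebra_simps)

section \<open>Additive minorants of sublinear functions\<close>

text \<open>
  The Hahn--Banach setting with multiples restricted to \<open>\<nat>\<close>: the majorants built below from a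
  commutative monoid use differences of its elements, which have integer but no real multiples.
  The carrier \<open>V\<close> is explicit because the bounded functions on a set do not form a type.
\<close>

locale additive_subgroup =
  fixes V :: "'v::ab_group_add set"
  assumes zero: "0 \<in> V"
    and add: "\<And>u v. u \<in> V \<Longrightarrow> v \<in> V \<Longrightarrow> u + v \<in> V"
    and uminus: "\<And>u. u \<in> V \<Longrightarrow> - u \<in> V"
begin

lemma mult: "u \<in> V \<Longrightarrow> nat_multiple n u \<in> V"
  by (induction n) (simp_all add: zero add nat_multiple_Suc)

definition sublinear :: "('v \<Rightarrow> real) \<Rightarrow> bool" where
  "sublinear q \<longleftrightarrow> (\<forall>u\<in>V. \<forall>v\<in>V. q (u + v) \<le> q u + q v) \<and> (\<forall>u\<in>V. \<forall>n. q (nat_multiple n u) = real n * q u)"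

lemma sublinear_0: "sublinear q \<Longrightarrow> q 0 = 0"
  using zero unfolding sublinear_def by (metis mult_zero_left nat_multiple_0 of_nat_0)

lemma sublinear_lower: "sublinear q \<Longrightarrow> u \<in> V \<Longrightarrow> - q (- u) \<le> q u"
proof -
  assume q: "sublinear q" and u: "u \<in> V"
  then have "q (u + - u) \<le> q u + q (- u)" using uminus unfolding sublinear_def by blast
  then show ?thesis using sublinear_0[OF q] by simp
qed

text \<open>
  The classical one-step modification in the proof of the Hahn--Banach theorem, with the scalar
  restricted to \<open>\<nat>\<close>: it lowers \<open>q\<close> just enough to make it additive in the direction \<open>v\<close>.
\<close>

definition tilt :: "('v \<Rightarrow> real) \<Rightarrow> 'v \<Rightarrow> 'v \<Rightarrow> real" where
  "tilt q v u = (INF n. q (u + nat_multiple n v) - real n * q v)"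

lemma tilt_bdd:
  assumes q: "sublinear q" and v: "v \<in> V" and u: "u \<in> V"
  shows "bdd_below (range (\<lambda>n. q (u + nat_multiple n v) - real n * q v))"
proof (rule bdd_belowI2)
  fix n
  have "q ((u + nat_multiple n v) + - u) \<le> q (u + nat_multiple n v) + q (- u)"
    using q u mult[OF v] add uminus unfolding sublinear_def by blast
  moreover have "q (nat_multiple n v) = real n * q v" using q v by (simp add: sublinear_def)
  ultimately show "- q (- u) \<le> q (u + nat_multiple n v) - real n * q v" by simp
qed

lemma tilt_upper:
  assumes "sublinear q" "v \<in> V" "u \<in> V"
  shows "tilt q v u \<le> q (u + nat_multiple n v) - real n * q v"
  unfolding tilt_def by (rule cINF_lower[OF tilt_bdd[OF assms]]) simp

lemma tilt_le:
  assumes "sublinear q" "v \<in> V" "u \<in> V"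
  shows "tilt q v u \<le> q u"
  using tilt_upper[OF assms, of 0] by simp

lemma tilt_greatest:
  assumes "\<And>n. a \<le> q (u + nat_multiple n v) - real n * q v"
  shows "a \<le> tilt q v u"
  unfolding tilt_def using assms by (intro cINF_greatest) auto

text \<open>
  Subadditivity follows by adding the parameters of two competitors. Homogeneity is where the
  restriction to natural parameters costs something: a parameter \<open>n\<close> for \<open>k \<cdot> u\<close> need not be
  divisible by \<open>k\<close>, so \<open>n\<close> is rounded up to \<open>k * m\<close>, and the added \<open>r\<close> copies of \<open>v\<close> are paid for by
  subadditivity.
\<close>

lemma sublinear_tilt:
  assumes q: "sublinear q" and v: "v \<in> V"
  shows "sublinear (tilt q v)"
  unfolding sublinear_def
proof (intro conjI ballI allI)
  have subadd: "q (a + b) \<le> q a + q b" if "a \<in> V" "b \<in> V" for a b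
    using q that by (simp add: sublinear_def)
  have homog: "q (nat_multiple n a) = real n * q a" if "a \<in> V" for a n
    using q that by (simp add: sublinear_def)
  show "tilt q v (u + w) \<le> tilt q v u + tilt q v w" if u: "u \<in> V" and w: "w \<in> V" for u w
  proof -
    have "tilt q v (u + w) - (q (w + nat_multiple m v) - real m * q v) \<le> tilt q v u" for m
    proof (rule tilt_greatest)
      fix n
      have "tilt q v (u + w) \<le> q ((u + w) + nat_multiple (n + m) v) - real (n + m) * q v"
        by (rule tilt_upper[OF q v add[OF u w]])
      also have "(u + w) + nat_multiple (n + m) v = (u + nat_multiple n v) + (w + nat_multiple m v)"
        by (simp add: nat_multiple_add algebra_simps)
      also have "q \<dots> \<le> q (u + nat_multiple n v) + q (w + nat_multiple m v)"
        by (intro subadd add u w mult v)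
      finally show "tilt q v (u + w) - (q (w + nat_multiple m v) - real m * q v) \<le> q (u + nat_multiple n v) - real n * q v"
        by (simp add: algebra_simps)
    qed
    then have "tilt q v (u + w) - tilt q v u \<le> q (w + nat_multiple m v) - real m * q v" for m
      by (simp add: algebra_simps)
    then have "tilt q v (u + w) - tilt q v u \<le> tilt q v w"
      by (rule tilt_greatest)
    then show ?thesis by simp
  qed
  show "tilt q v (nat_multiple k u) = real k * tilt q v u" if u: "u \<in> V" for u k
  proof (cases "k = 0")
    case True
    have "tilt q v 0 = 0"
      using tilt_le[OF q v zero] tilt_greatest[of 0 q 0 v] homog[OF v] sublinear_0[OF q] by simp
    then show ?thesis using True by simp
  next
    case k: False
    show ?thesis
    proof (rule antisym)
      have "tilt q v (nat_multiple k u) / real k \<le> tilt q v u"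
      proof (rule tilt_greatest)
        fix n
        have "tilt q v (nat_multiple k u) \<le> q (nat_multiple k u + nat_multiple (k * n) v) - real (k * n) * q v"
          by (intro tilt_upper q v mult u)
        also have "nat_multiple k u + nat_multiple (k * n) v = nat_multiple k (u + nat_multiple n v)"
          by (simp add: nat_multiple_plus nat_multiple_mult)
        also have "q \<dots> = real k * q (u + nat_multiple n v)"
          by (intro homog add u mult v)
        finally show "tilt q v (nat_multiple k u) / real k \<le> q (u + nat_multiple n v) - real n * q v"
          using k by (simp add: field_simps)
      qed
      then show "tilt q v (nat_multiple k u) \<le> real k * tilt q v u"
        using k by (simp add: field_simps)
      show "real k * tilt q v u \<le> tilt q v (nat_multiple k u)"
      proof (rule tilt_greatest)
        fix n
        define m r where "m = Suc (n div k)" and "r = k - n mod k"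
        have nr: "n + r = k * m"
        proof -
          have "n + r = k * (n div k) + (n mod k + r)" by simp
          also have "n mod k + r = k" using k by (simp add: r_def less_imp_le)
          finally show ?thesis by (simp add: m_def)
        qed
        have "real k * tilt q v u \<le> real k * (q (u + nat_multiple m v) - real m * q v)"
          by (intro mult_left_mono tilt_upper q v u) simp
        also have "\<dots> = q (nat_multiple k (u + nat_multiple m v)) - real (k * m) * q v"
          using homog[OF add[OF u mult[OF v]]] by (simp add: algebra_simps)
        also have "nat_multiple k (u + nat_multiple m v) = (nat_multiple k u + nat_multiple n v) + nat_multiple r v"
          by (simp only: nat_multiple_plus nat_multiple_mult[symmetric] nr[symmetric] nat_multiple_add add.assoc)
        also have "q \<dots> \<le> q (nat_multiple k u + nat_multiple n v) + real r * q v"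
          using subadd[of "nat_multiple k u + nat_multiple n v" "nat_multiple r v"] homog[OF v, of r]
          by (simp add: add mult u v)
        also have "\<dots> - real (k * m) * q v = q (nat_multiple k u + nat_multiple n v) - real n * q v"
          unfolding nr[symmetric] by (simp add: algebra_simps)
        finally show "real k * tilt q v u \<le> q (nat_multiple k u + nat_multiple n v) - real n * q v" by simp
      qed
    qed
  qed
qed

lemma sublinear_cong: "sublinear q \<Longrightarrow> (\<And>u. u \<in> V \<Longrightarrow> r u = q u) \<Longrightarrow> sublinear r"
  unfolding sublinear_def by (simp add: add mult)

text \<open>
  In a chain any two members have a common lower bound in the chain, so an estimate that mixes
  two members follows from the estimate for a single one.
\<close>

lemma sublinear_INF:
  assumes ne: "C \<noteq> {}" and sub: "\<And>q. q \<in> C \<Longrightarrow> sublinear q"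
    and chain: "\<And>q r. q \<in> C \<Longrightarrow> r \<in> C \<Longrightarrow> q \<le> r \<or> r \<le> q"
    and bdd: "\<And>u. u \<in> V \<Longrightarrow> bdd_below ((\<lambda>q. q u) ` C)"
  shows "sublinear (\<lambda>u. INF q\<in>C. q u)"
  unfolding sublinear_def
proof (intro conjI ballI allI)
  let ?r = "\<lambda>u. INF q\<in>C. q u"
  have lower: "?r u \<le> q u" if "u \<in> V" "q \<in> C" for u q using cINF_lower[OF bdd] that .
  show "?r (u + v) \<le> ?r u + ?r v" if u: "u \<in> V" and v: "v \<in> V" for u v
  proof -
    have *: "?r (u + v) \<le> q u + r v" if q: "q \<in> C" and r: "r \<in> C" for q r
    proof -
      obtain s where s: "s \<in> C" "s \<le> q" "s \<le> r" using chain[OF q r] q r by blast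
      have "?r (u + v) \<le> s (u + v)" using lower add u v s by blast
      also have "\<dots> \<le> s u + s v" using sub[OF s(1)] u v by (simp add: sublinear_def)
      also have "\<dots> \<le> q u + r v" using s by (intro add_mono) (auto simp: le_fun_def)
      finally show ?thesis .
    qed
    have "?r (u + v) - r v \<le> ?r u" if "r \<in> C" for r
      using *[OF _ that] ne by (intro cINF_greatest) (auto simp: algebra_simps)
    then have "?r (u + v) - ?r u \<le> ?r v"
      using ne by (intro cINF_greatest) (auto simp: algebra_simps)
    then show ?thesis by simp
  qed
  show "?r (nat_multiple n u) = real n * ?r u" if u: "u \<in> V" for n u
  proof -
    have "?r (nat_multiple n u) = (INF q\<in>C. real n * q u)"
      using sub u by (intro INF_cong) (auto simp: sublinear_def)
    also have "\<dots> = real n * ?r u"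
    proof (cases "n = 0")
      case False
      show ?thesis
      proof (rule antisym)
        have "bdd_below ((\<lambda>q. real n * q u) ` C)"
          using lower[OF u] by (intro bdd_belowI2[of _ "real n * ?r u"] mult_left_mono) auto
        then have "(INF q\<in>C. real n * q u) / real n \<le> q u" if "q \<in> C" for q
          using cINF_lower[of "\<lambda>q. real n * q u" C q] that False by (simp add: field_simps)
        then have "(INF q\<in>C. real n * q u) / real n \<le> ?r u" using ne by (intro cINF_greatest)
        then show "(INF q\<in>C. real n * q u) \<le> real n * ?r u" using False by (simp add: field_simps)
        show "real n * ?r u \<le> (INF q\<in>C. real n * q u)"
          using ne lower[OF u] by (intro cINF_greatest mult_left_mono) auto
      qed
    qed (use ne in simp)
    finally show ?thesis .
  qed
qed

text \<open>
  A minimal sublinear function \<open>q\<close> below \<open>p\<close> is additive, because \<open>tilt q v\<close> is again such a function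
  and hence equal to \<open>q\<close>; taking the parameter \<open>1\<close> in the infimum gives
  \<open>q u \<le> q (u + v) - q v\<close>. Zorn's lemma supplies a minimal one.
\<close>

theorem additive_minorant:
  assumes p: "sublinear p"
  obtains q where "\<And>u v. u \<in> V \<Longrightarrow> v \<in> V \<Longrightarrow> q (u + v) = q u + q v" "\<And>u. u \<in> V \<Longrightarrow> q u \<le> p u"
proof -
  \<comment> \<open>Prescribing the value 0 outside \<open>V\<close> makes the pointwise order antisymmetric on \<open>Q\<close>.\<close>
  define Q where "Q = {q. sublinear q \<and> (\<forall>u\<in>V. q u \<le> p u) \<and> (\<forall>u. u \<notin> V \<longrightarrow> q u = 0)}"
  have inQ: "(\<lambda>u. if u \<in> V then q u else 0) \<in> Q" if "sublinear q" "\<And>u. u \<in> V \<Longrightarrow> q u \<le> p u" for q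
    using that sublinear_cong[OF that(1), of "\<lambda>u. if u \<in> V then q u else 0"] by (simp add: Q_def)
  have "\<exists>q\<in>Q. \<forall>r\<in>Q. r \<le> q \<longrightarrow> r = q"
  proof (rule predicate_Zorn)
    show "partial_order_on Q (relation_of (\<lambda>q r. r \<le> q) Q)"
      by (rule partial_order_on_relation_ofI) auto
    fix C assume C: "C \<in> Chains (relation_of (\<lambda>q r. r \<le> q) Q)"
    show "\<exists>r\<in>Q. \<forall>q\<in>C. r \<le> q"
    proof (cases "C = {}")
      case True
      then show ?thesis using inQ[OF p] by auto
    next
      case False
      have CQ: "\<And>q. q \<in> C \<Longrightarrow> q \<in> Q" and chain: "\<And>q r. q \<in> C \<Longrightarrow> r \<in> C \<Longrightarrow> q \<le> r \<or> r \<le> q"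
        using C unfolding Chains_def relation_of_def by blast+
      have bdd: "bdd_below ((\<lambda>q. q u) ` C)" if u: "u \<in> V" for u
      proof (rule bdd_belowI2)
        fix q assume "q \<in> C"
        then have q: "q \<in> Q" by (rule CQ)
        then have "q (- u) \<le> p (- u)" using uminus[OF u] by (simp add: Q_def)
        then show "- p (- u) \<le> q u" using q u sublinear_lower[of q u] by (simp add: Q_def)
      qed
      let ?r = "\<lambda>u. INF q\<in>C. q u"
      have lower: "?r u \<le> q u" if "u \<in> V" "q \<in> C" for u q using cINF_lower[OF bdd] that .
      have "sublinear ?r"
        using False CQ chain bdd by (intro sublinear_INF) (auto simp: Q_def)
      moreover have "?r u \<le> p u" if u: "u \<in> V" for u
      proof -
        obtain q where q: "q \<in> C" using False by auto
        then have "?r u \<le> q u" using lower u by blast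
        also have "\<dots> \<le> p u" using CQ[OF q] u by (simp add: Q_def)
        finally show ?thesis .
      qed
      ultimately have "(\<lambda>u. if u \<in> V then ?r u else 0) \<in> Q" by (rule inQ)
      moreover have "(\<lambda>u. if u \<in> V then ?r u else 0) \<le> q" if q: "q \<in> C" for q
        using lower[OF _ q] CQ[OF q] by (auto simp: le_fun_def Q_def)
      ultimately show ?thesis by blast
    qed
  qed
  then obtain q where q: "q \<in> Q" and min: "\<And>r. r \<in> Q \<Longrightarrow> r \<le> q \<Longrightarrow> r = q" by blast
  have sub: "sublinear q" and le: "\<And>u. u \<in> V \<Longrightarrow> q u \<le> p u" using q by (auto simp: Q_def)
  have "q (u + v) = q u + q v" if u: "u \<in> V" and v: "v \<in> V" for u v
  proof -
    let ?t = "\<lambda>u. if u \<in> V then tilt q v u else 0"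
    have "?t \<in> Q"
      using sublinear_tilt[OF sub v] tilt_le[OF sub v] le by (intro inQ) (auto intro: order_trans)
    moreover have "?t \<le> q" using tilt_le[OF sub v] q by (auto simp: le_fun_def Q_def)
    ultimately have "?t = q" by (rule min)
    then have "q u = tilt q v u" using u by (auto dest: fun_cong[of _ _ u])
    also have "\<dots> \<le> q (u + v) - q v" using tilt_upper[OF sub v u, of "Suc 0"] by simp
    finally show ?thesis using sub u v by (auto simp: sublinear_def intro: antisym)
  qed
  then show ?thesis using that le by blast
qed

end

section \<open>Positive functionals on bounded functions extending evaluations\<close>

text \<open>
  \<open>X\<close> is a set of additive functions, and \<open>f\<close> is an additive function that respects every
  inequality \<open>h x \<le> h y + t\<close> valid throughout \<open>X\<close>, with \<open>c\<close> in the role of the total mass. These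
  conditions are necessary for \<open>f x = \<integral> h x d\<mu>(h)\<close> with a measure \<open>\<mu>\<close> of mass \<open>c\<close> on \<open>X\<close>; they turn
  out to be sufficient for a finitely additive version of this representation.
\<close>

locale dominated_functional =
  fixes X :: "('a::comm_monoid_add \<Rightarrow> real) set" and f :: "'a \<Rightarrow> real" and c :: real
  assumes add_X: "\<And>h x y. h \<in> X \<Longrightarrow> h (x + y) = h x + h y"
    and zero_X: "\<And>h. h \<in> X \<Longrightarrow> h 0 = 0"
    and bounded_X: "\<And>x. bounded ((\<lambda>h. h x) ` X)"
    and add_f: "\<And>x y. f (x + y) = f x + f y"
    and zero_f: "f 0 = 0"
    and dominated: "\<And>x y t. (\<And>h. h \<in> X \<Longrightarrow> h x \<le> h y + t) \<Longrightarrow> f x \<le> f y + t * c"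
begin

definition V :: "(('a \<Rightarrow> real) \<Rightarrow> real) set" where
  "V = {g. bounded (g ` X)}"

sublocale additive_subgroup V
  by unfold_locales
    (auto simp: V_def zero_fun_def plus_fun_def fun_Compl_def image_constant_conv bounded_plus_comp
      bounded_uminus image_image[symmetric])

text \<open>
  The functions \<open>h \<mapsto> (h x - h y) / n + t\<close> are those on which the value of the functional is forced
  by \<open>f\<close> and \<open>c\<close>. Dividing by \<open>n\<close> is what makes \<open>upper\<close> homogeneous.
\<close>

definition majorant :: "(('a \<Rightarrow> real) \<Rightarrow> real) \<Rightarrow> 'a \<Rightarrow> 'a \<Rightarrow> nat \<Rightarrow> real \<Rightarrow> bool" where
  "majorant g x y n t \<longleftrightarrow> 0 < n \<and> (\<forall>h\<in>X. g h \<le> (h x - h y) / n + t)"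

definition upper :: "(('a \<Rightarrow> real) \<Rightarrow> real) \<Rightarrow> real" where
  "upper g = Inf {(f x - f y) / n + t * c | x y n t. majorant g x y n t}"

lemma nat_multiple_X: "h \<in> X \<Longrightarrow> h (nat_multiple n x) = real n * h x"
  by (induction n) (simp_all add: nat_multiple_Suc add_X zero_X algebra_simps)

lemma nat_multiple_f: "f (nat_multiple n x) = real n * f x"
  by (induction n) (simp_all add: nat_multiple_Suc add_f zero_f algebra_simps)

text \<open>
  This is the only place where the domination hypothesis enters: it keeps the infimum defining
  \<open>upper\<close> from being too small.
\<close>

lemma majorant_lower:
  assumes g: "\<And>h. h \<in> X \<Longrightarrow> - b \<le> g h" and maj: "majorant g x y n t"
  shows "- b * c \<le> (f x - f y) / n + t * c"
proof -
  have n: "0 < n" using maj by (simp add: majorant_def)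
  have "h y \<le> h x + real n * (t + b)" if h: "h \<in> X" for h
  proof -
    have "- b \<le> (h x - h y) / n + t" using g[OF h] maj h unfolding majorant_def by (meson order_trans)
    then show ?thesis using n by (simp add: field_simps)
  qed
  then have "f y \<le> f x + real n * (t + b) * c" by (rule dominated)
  then show ?thesis using n by (simp add: field_simps)
qed

lemma majorant_const:
  assumes "\<And>h. h \<in> X \<Longrightarrow> g h \<le> b"
  shows "majorant g 0 0 (Suc 0) b"
  using assms by (simp add: majorant_def)

lemma upper_nonempty: "g \<in> V \<Longrightarrow> {(f x - f y) / n + t * c | x y n t. majorant g x y n t} \<noteq> {}"
proof -
  assume "g \<in> V"
  then obtain b where "\<And>h. h \<in> X \<Longrightarrow> \<bar>g h\<bar> \<le> b" by (auto simp: V_def bounded_iff)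
  then have "majorant g 0 0 (Suc 0) b" by (intro majorant_const) (simp add: abs_le_iff)
  then show ?thesis by blast
qed

lemma upper_le: "g \<in> V \<Longrightarrow> majorant g x y n t \<Longrightarrow> upper g \<le> (f x - f y) / n + t * c"
  unfolding upper_def
proof (rule cInf_lower)
  assume "g \<in> V"
  then obtain b where "\<And>h. h \<in> X \<Longrightarrow> \<bar>g h\<bar> \<le> b" by (auto simp: V_def bounded_iff)
  then have b: "\<And>h. h \<in> X \<Longrightarrow> - b \<le> g h" by (simp add: abs_le_iff minus_le_iff)
  show "bdd_below {(f x - f y) / n + t * c | x y n t. majorant g x y n t}"
    using majorant_lower[OF b] by (intro bdd_belowI[of _ "- b * c"]) auto
qed auto

lemma le_upper:
  assumes "g \<in> V" "\<And>x y n t. majorant g x y n t \<Longrightarrow> a \<le> (f x - f y) / n + t * c"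
  shows "a \<le> upper g"
  unfolding upper_def using assms upper_nonempty by (intro cInf_greatest) auto

lemma upper_add:
  assumes g: "g \<in> V" and g': "g' \<in> V"
  shows "upper (g + g') \<le> upper g + upper g'"
proof -
  have *: "upper (g + g') \<le> ((f x - f y) / n + t * c) + ((f x' - f y') / n' + t' * c)"
    if m: "majorant g x y n t" and m': "majorant g' x' y' n' t'" for x y n t x' y' n' t'
  proof -
    have n: "0 < n" "0 < n'" using m m' by (auto simp: majorant_def)
    let ?x = "nat_multiple n' x + nat_multiple n x'" and ?y = "nat_multiple n' y + nat_multiple n y'"
    have "(g + g') h \<le> (h ?x - h ?y) / real (n * n') + (t + t')" if h: "h \<in> X" for h
    proof -
      have "g h + g' h \<le> ((h x - h y) / n + t) + ((h x' - h y') / n' + t')"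
        using m m' h unfolding majorant_def by (intro add_mono) auto
      also have "\<dots> = (h ?x - h ?y) / real (n * n') + (t + t')"
        using n h by (simp add: add_X nat_multiple_X field_simps)
      finally show ?thesis by simp
    qed
    then have "majorant (g + g') ?x ?y (n * n') (t + t')" using n by (simp add: majorant_def)
    then have "upper (g + g') \<le> (f ?x - f ?y) / real (n * n') + (t + t') * c"
      by (intro upper_le add g g')
    also have "\<dots> = ((f x - f y) / n + t * c) + ((f x' - f y') / n' + t' * c)"
      using n by (simp add: add_f nat_multiple_f field_simps)
    finally show ?thesis .
  qed
  have "upper (g + g') - ((f x' - f y') / n' + t' * c) \<le> upper g"
    if m': "majorant g' x' y' n' t'" for x' y' n' t'
    using *[OF _ m'] by (intro le_upper[OF g]) (simp add: algebra_simps)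
  then have "upper (g + g') - upper g \<le> upper g'"
    by (intro le_upper[OF g']) (simp add: algebra_simps)
  then show ?thesis by simp
qed

lemma upper_mult:
  assumes g: "g \<in> V"
  shows "upper (nat_multiple k g) = real k * upper g"
proof (cases "k = 0")
  case True
  have "upper 0 \<le> 0" using upper_le[OF zero majorant_const[of 0 0]] zero_f by simp
  moreover have "0 \<le> upper 0" using majorant_lower[of 0 0] by (intro le_upper zero) auto
  ultimately show ?thesis using True by simp
next
  case k: False
  show ?thesis
  proof (rule antisym)
    have "upper (nat_multiple k g) / real k \<le> upper g"
    proof (rule le_upper[OF g])
      fix x y n t assume m: "majorant g x y n t"
      have "real k * g h \<le> (h (nat_multiple k x) - h (nat_multiple k y)) / n + real k * t"
        if h: "h \<in> X" for h
      proof -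
        have "real k * g h \<le> real k * ((h x - h y) / n + t)"
          using m h by (intro mult_left_mono) (auto simp: majorant_def)
        then show ?thesis using h by (simp add: nat_multiple_X algebra_simps diff_divide_distrib)
      qed
      then have "majorant (nat_multiple k g) (nat_multiple k x) (nat_multiple k y) n (real k * t)"
        using m by (simp add: majorant_def nat_multiple_fun)
      from upper_le[OF mult[OF g] this]
      show "upper (nat_multiple k g) / real k \<le> (f x - f y) / n + t * c"
        using k by (simp add: nat_multiple_f field_simps)
    qed
    then show "upper (nat_multiple k g) \<le> real k * upper g" using k by (simp add: field_simps)
    show "real k * upper g \<le> upper (nat_multiple k g)"
    proof (rule le_upper[OF mult[OF g]])
      fix x y n t assume m: "majorant (nat_multiple k g) x y n t"
      have "g h \<le> (h x - h y) / real (k * n) + t / real k" if h: "h \<in> X" for h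
      proof -
        have "real k * g h \<le> (h x - h y) / n + t"
          using m h by (auto simp: majorant_def nat_multiple_fun)
        then have "g h \<le> ((h x - h y) / n + t) / real k" using k by (simp add: field_simps)
        then show ?thesis by (simp add: add_divide_distrib mult.commute)
      qed
      then have "majorant g x y (k * n) (t / real k)" using m k by (simp add: majorant_def)
      from mult_left_mono[OF upper_le[OF g this], of "real k"]
      show "real k * upper g \<le> (f x - f y) / n + t * c"
        using k by (simp add: distrib_left)
    qed
  qed
qed

text \<open>
  An additive \<open>L\<close> below \<open>upper\<close> has all the required properties, since \<open>upper\<close> is at most \<open>0\<close> on
  nonpositive functions, at most \<open>f x\<close> at the evaluation at \<open>x\<close>, and at most \<open>- f x\<close> at its negative.
\<close>

theorem positive_extension:
  obtains L where
    "\<And>g g'. bounded (g ` X) \<Longrightarrow> bounded (g' ` X) \<Longrightarrow> L (\<lambda>h. g h + g' h) = L g + L g'"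
    "\<And>g g'. bounded (g ` X) \<Longrightarrow> bounded (g' ` X) \<Longrightarrow> (\<And>h. h \<in> X \<Longrightarrow> g h \<le> g' h) \<Longrightarrow> L g \<le> L g'"
    "\<And>x. L (\<lambda>h. h x) = f x"
proof -
  have "sublinear upper" unfolding sublinear_def using upper_add upper_mult by blast
  then obtain L where L: "\<And>g g'. g \<in> V \<Longrightarrow> g' \<in> V \<Longrightarrow> L (g + g') = L g + L g'"
    and le: "\<And>g. g \<in> V \<Longrightarrow> L g \<le> upper g"
    using additive_minorant by metis
  have L0: "L 0 = 0" using L[OF zero zero] by simp
  have Lm: "L (- g) = - L g" if "g \<in> V" for g
    using L[OF that uminus[OF that]] L0 by simp
  show ?thesis
  proof
    show "L (\<lambda>h. g h + g' h) = L g + L g'" if "bounded (g ` X)" "bounded (g' ` X)" for g g'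
      using L[of g g'] that by (simp add: V_def plus_fun_def)
    show "L g \<le> L g'" if "bounded (g ` X)" "bounded (g' ` X)" "\<And>h. h \<in> X \<Longrightarrow> g h \<le> g' h" for g g'
    proof -
      have V: "g \<in> V" "g' \<in> V" using that by (auto simp: V_def)
      then have gV: "g + - g' \<in> V" by (intro add uminus)
      have "majorant (g + - g') 0 0 (Suc 0) 0" using that(3) by (intro majorant_const) simp
      then have "L (g + - g') \<le> 0" using le[OF gV] upper_le[OF gV] zero_f by fastforce
      then show ?thesis using L[OF V(1) uminus[OF V(2)]] Lm[OF V(2)] by simp
    qed
    show "L (\<lambda>h. h x) = f x" for x
    proof (rule antisym)
      let ?e = "\<lambda>h::'a \<Rightarrow> real. h x"
      have e: "?e \<in> V" using bounded_X by (simp add: V_def)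
      have "majorant ?e x 0 (Suc 0) 0" "majorant (- ?e) 0 x (Suc 0) 0"
        by (simp_all add: majorant_def zero_X)
      from upper_le[OF e this(1)] upper_le[OF uminus[OF e] this(2)]
      have "upper ?e \<le> f x" "upper (- ?e) \<le> - f x" by (simp_all add: zero_f)
      then show "L ?e \<le> f x" "f x \<le> L ?e"
        using le[OF e] le[OF uminus[OF e]] Lm[OF e] by linarith+
    qed
  qed
qed

end

section \<open>Regularization of finitely additive set functions\<close>

text \<open>
  A finitely additive set function \<open>m\<close> on all subsets, chosen independently of the topology, is
  regularized to a measure: open sets are measured from inside by closed sets, and
  arbitrary sets from outside by open sets. Compactness supplies the countable subadditivity that
  \<open>m\<close> itself may lack. The resulting measure need not agree with \<open>m\<close>, but it dominates \<open>m\<close> on closed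
  sets and has the same total mass, which is enough to recover integrals of continuous functions.
\<close>

locale additive_on_compact_Hausdorff =
  fixes T :: "'b topology" and m :: "'b set \<Rightarrow> ennreal"
  assumes compact: "compact_space T"
    and Hausdorff: "Hausdorff_space T"
    and additive: "\<And>A B. \<lbrakk>A \<subseteq> topspace T; B \<subseteq> topspace T; A \<inter> B = {}\<rbrakk> \<Longrightarrow> m (A \<union> B) = m A + m B"
    and finite_total: "m (topspace T) < \<infinity>"
begin

definition inner_content :: "'b set \<Rightarrow> ennreal" where
  "inner_content U = (SUP C\<in>{C. closedin T C \<and> C \<subseteq> U}. m C)"

definition outer_content :: "'b set \<Rightarrow> ennreal" where
  "outer_content E = (INF U\<in>{U. openin T U \<and> E \<subseteq> U}. inner_content U)"

lemma m_mono: 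
  assumes "A \<subseteq> B" "B \<subseteq> topspace T"
  shows "m A \<le> m B"
proof -
  have "m B = m (A \<union> (B - A))" using assms by (simp add: Un_absorb1)
  also have "\<dots> = m A + m (B - A)" using assms by (intro additive) auto
  finally show ?thesis by simp
qed

lemma m_empty: "m {} = 0"
proof -
  have "m {} + 0 = m {} + m {}" using additive[of "{}" "{}"] by simp
  moreover have "m {} \<noteq> \<infinity>" using m_mono[of "{}" "topspace T"] finite_total by (auto simp: top_unique)
  ultimately show ?thesis by (metis ennreal_add_left_cancel infinity_ennreal_def)
qed

lemma m_subadd:
  assumes "A \<subseteq> topspace T" "B \<subseteq> topspace T"
  shows "m (A \<union> B) \<le> m A + m B"
proof -
  have "m (A \<union> B) = m (A \<union> (B - A))" by simp
  also have "\<dots> = m A + m (B - A)" using assms by (intro additive) auto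
  also have "\<dots> \<le> m A + m B" using assms by (intro add_left_mono m_mono) auto
  finally show ?thesis .
qed

lemma inner_upper: "closedin T C \<Longrightarrow> C \<subseteq> U \<Longrightarrow> m C \<le> inner_content U"
  unfolding inner_content_def by (auto intro: SUP_upper)

lemma inner_mono: "U \<subseteq> V \<Longrightarrow> inner_content U \<le> inner_content V"
  unfolding inner_content_def by (rule SUP_subset_mono) auto

lemma inner_subset_le: "inner_content A \<le> m (topspace T)"
  unfolding inner_content_def by (rule SUP_least) (auto intro: m_mono dest: closedin_subset)

lemma inner_empty: "inner_content {} = 0"
  by (simp add: inner_content_def m_empty)

lemma inner_topspace: "inner_content (topspace T) = m (topspace T)"
  by (intro antisym inner_subset_le inner_upper) auto

text \<open>
  By normality a closed set covered by two open sets is the union of two closed sets, one inside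
  each of them.
\<close>

lemma closed_le_inner_Un:
  assumes "openin T U" "openin T V" "closedin T C" "C \<subseteq> U \<union> V"
  shows "m C \<le> inner_content U + inner_content V"
proof -
  have "normal_space T"
    using compact Hausdorff compact_Hausdorff_or_regular_imp_normal_space by blast
  moreover have "closedin T (C - U)" "closedin T (C - V)" "disjnt (C - U) (C - V)"
    using assms by (auto simp: disjnt_def)
  ultimately obtain P Q where PQ: "openin T P" "openin T Q" "C - U \<subseteq> P" "C - V \<subseteq> Q" "disjnt P Q"
    unfolding normal_space_def by meson
  have "C = (C - P) \<union> (C - Q)" using PQ(5) by (auto simp: disjnt_def)
  then have "m C \<le> m (C - P) + m (C - Q)"
    using m_subadd[of "C - P" "C - Q"] closedin_subset[OF assms(3)] by auto
  also have "\<dots> \<le> inner_content U + inner_content V"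
    using PQ assms by (intro add_mono inner_upper) auto
  finally show ?thesis .
qed

lemma inner_Un:
  assumes "openin T U" "openin T V"
  shows "inner_content (U \<union> V) \<le> inner_content U + inner_content V"
  unfolding inner_content_def[of "U \<union> V"] using closed_le_inner_Un[OF assms] by (auto intro: SUP_least)

lemma inner_finite_UN:
  assumes "finite I" "\<And>i. i \<in> I \<Longrightarrow> openin T (U i)"
  shows "inner_content (\<Union>i\<in>I. U i) \<le> (\<Sum>i\<in>I. inner_content (U i))"
  using assms
proof (induction I rule: finite_induct)
  case (insert i I)
  have "inner_content (U i \<union> (\<Union>i\<in>I. U i)) \<le> inner_content (U i) + inner_content (\<Union>i\<in>I. U i)"
    using insert.prems by (intro inner_Un openin_Union) auto
  also have "\<dots> \<le> inner_content (U i) + (\<Sum>i\<in>I. inner_content (U i))"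
    using insert by (intro add_left_mono) auto
  finally show ?case using insert by simp
qed (simp add: inner_empty)

text \<open>
  Compactness of closed sets turns a countable open cover into a finite one.
\<close>

lemma inner_UN:
  fixes U :: "nat \<Rightarrow> 'b set"
  assumes "\<And>i. openin T (U i)"
  shows "inner_content (\<Union>i. U i) \<le> (\<Sum>i. inner_content (U i))"
  unfolding inner_content_def[of "\<Union>i. U i"]
proof (rule SUP_least, clarify)
  fix C assume C: "closedin T C" "C \<subseteq> (\<Union>i. U i)"
  have "compactin T C" using compact C(1) closedin_compact_space by blast
  then obtain F where F: "finite F" "F \<subseteq> range U" "C \<subseteq> \<Union>F"
    using compactinD[of T C "range U"] C(2) assms by blast
  then obtain I where I: "finite I" "F = U ` I" by (meson finite_subset_image)
  have "m C \<le> inner_content (\<Union>i\<in>I. U i)" using F I C by (intro inner_upper) auto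
  also have "\<dots> \<le> (\<Sum>i\<in>I. inner_content (U i))" using I assms by (intro inner_finite_UN) auto
  also have "\<dots> \<le> (\<Sum>i. inner_content (U i))" using I by (intro sum_le_suminf) auto
  finally show "m C \<le> (\<Sum>i. inner_content (U i))" .
qed

lemma outer_le_inner: "openin T U \<Longrightarrow> E \<subseteq> U \<Longrightarrow> outer_content E \<le> inner_content U"
  unfolding outer_content_def by (auto intro: INF_lower)

lemma outer_mono: "A \<subseteq> B \<Longrightarrow> outer_content A \<le> outer_content B"
  unfolding outer_content_def by (rule INF_superset_mono) auto

lemma outer_open: "openin T U \<Longrightarrow> outer_content U = inner_content U"
  unfolding outer_content_def by (auto intro!: antisym INF_lower INF_greatest inner_mono)

lemma le_outer_closed: "closedin T C \<Longrightarrow> m C \<le> outer_content C"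
  unfolding outer_content_def by (auto intro!: INF_greatest inner_upper)

lemma outer_countably_subadditive: "countably_subadditive (Pow (topspace T)) outer_content"
  unfolding countably_subadditive_def
proof (intro allI impI)
  fix A :: "nat \<Rightarrow> 'b set"
  show "outer_content (\<Union>i. A i) \<le> (\<Sum>i. outer_content (A i))"
  proof (rule ennreal_le_epsilon)
    fix e :: real assume "0 < e" "(\<Sum>i. outer_content (A i)) < top"
    then have "outer_content (A n) < outer_content (A n) + e * (1/2)^Suc n" for n
      by (auto simp add: less_top dest!: ennreal_suminf_lessD)
    then have "\<exists>U. openin T U \<and> A n \<subseteq> U \<and> inner_content U < outer_content (A n) + e * (1/2)^Suc n" for n
      by (subst (asm) outer_content_def) (auto simp: INF_less_iff)
    then obtain U where U: "\<And>n. openin T (U n)" "\<And>n. A n \<subseteq> U n"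
      "\<And>n. inner_content (U n) < outer_content (A n) + e * (1/2)^Suc n"
      by metis
    have "outer_content (\<Union>i. A i) \<le> inner_content (\<Union>i. U i)"
      using U by (intro outer_le_inner openin_Union) auto
    also have "\<dots> \<le> (\<Sum>i. inner_content (U i))" by (rule inner_UN) fact
    also have "\<dots> \<le> (\<Sum>n. outer_content (A n) + e * (1/2) ^ Suc n)"
      using U(3) by (intro suminf_le allI less_imp_le) auto
    also have "\<dots> = (\<Sum>n. outer_content (A n)) + (\<Sum>n. ennreal e * ennreal ((1/2) ^ Suc n))"
      using \<open>0 < e\<close> by (subst suminf_add[symmetric])
                       (auto simp del: ennreal_suminf_cmult simp add: ennreal_mult[symmetric])
    also have "\<dots> = (\<Sum>n. outer_content (A n)) + e"
      unfolding ennreal_suminf_cmult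
      by (subst suminf_ennreal_eq[OF zero_le_power power_half_series]) auto
    finally show "outer_content (\<Union>i. A i) \<le> (\<Sum>i. outer_content (A i)) + e" .
  qed
qed

lemma outer_empty: "outer_content {} = 0"
  using outer_le_inner[of "{}" "{}"] by (simp add: inner_empty)

lemma outer_measure_space: "outer_measure_space (Pow (topspace T)) outer_content"
  unfolding outer_measure_space_def positive_def increasing_def
  by (simp add: outer_empty outer_mono outer_countably_subadditive)

text \<open>
  Caratheodory's inequality for open \<open>U\<close>: first exhaust \<open>V \<inter> U\<close> by a closed set \<open>C\<close>, then the open
  set \<open>V - C\<close> by a closed set \<open>D\<close>; the disjoint closed sets \<open>C\<close> and \<open>D\<close> both lie in \<open>V\<close>.
\<close>

lemma inner_split:
  assumes U: "openin T U" and V: "openin T V" "E \<subseteq> V"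
  shows "outer_content (E \<inter> U) + outer_content (E - U) \<le> inner_content V"
proof -
  have *: "m C + outer_content (E - U) \<le> inner_content V" if C: "closedin T C" "C \<subseteq> V \<inter> U" for C
  proof -
    have "outer_content (E - U) \<le> inner_content (V - C)"
      using C V by (intro outer_le_inner) auto
    then have "m C + outer_content (E - U) \<le> m C + inner_content (V - C)" by (intro add_left_mono)
    also have "\<dots> = (SUP D\<in>{D. closedin T D \<and> D \<subseteq> V - C}. m C + m D)"
      unfolding inner_content_def by (rule ennreal_SUP_add_right) auto
    also have "\<dots> \<le> inner_content V"
    proof (rule SUP_least, clarify)
      fix D assume D: "closedin T D" "D \<subseteq> V - C"
      have "m C + m D = m (C \<union> D)"
        using C D closedin_subset[of T] by (intro additive[symmetric]) auto
      also have "\<dots> \<le> inner_content V" using C D by (intro inner_upper) auto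
      finally show "m C + m D \<le> inner_content V" .
    qed
    finally show ?thesis .
  qed
  have "outer_content (E \<inter> U) + outer_content (E - U) \<le> inner_content (V \<inter> U) + outer_content (E - U)"
    using U V by (intro add_right_mono outer_le_inner) auto
  also have "\<dots> = (SUP C\<in>{C. closedin T C \<and> C \<subseteq> V \<inter> U}. m C + outer_content (E - U))"
    unfolding inner_content_def by (rule ennreal_SUP_add_left[symmetric]) auto
  also have "\<dots> \<le> inner_content V" using * by (intro SUP_least) auto
  finally show ?thesis .
qed

lemma open_in_lambda_system:
  assumes "openin T U"
  shows "U \<in> lambda_system (topspace T) (Pow (topspace T)) outer_content"
proof -
  interpret S: sigma_algebra "topspace T" "Pow (topspace T)" by (rule sigma_algebra_Pow)
  have "outer_content (E \<inter> U) + outer_content (E - U) = outer_content E" if "E \<subseteq> topspace T" for E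
  proof (rule antisym)
    show "outer_content (E \<inter> U) + outer_content (E - U) \<le> outer_content E"
      unfolding outer_content_def[of E] using inner_split[OF assms] by (intro INF_greatest) auto
    have "subadditive (Pow (topspace T)) outer_content"
      using outer_measure_space unfolding outer_measure_space_def
      by (intro S.countably_subadditive_subadditive) auto
    then have "outer_content ((E \<inter> U) \<union> (E - U)) \<le> outer_content (E \<inter> U) + outer_content (E - U)"
      using that by (intro subadditiveD) auto
    then show "outer_content E \<le> outer_content (E \<inter> U) + outer_content (E - U)" by (simp add: Un_Diff_Int Int_commute Un_commute)
  qed
  then show ?thesis
    using assms by (auto simp: S.lambda_system_eq dest: openin_subset)
qed

text \<open>
  Outer regularity is built into the definition of \<open>outer_content\<close>; inner regularity follows by
  passing to complements, because the total mass is finite and closed sets are compact.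
\<close>

theorem regular_measure:
  obtains \<mu> where "regular_borel_measure T \<mu>" "\<And>C. closedin T C \<Longrightarrow> m C \<le> emeasure \<mu> C"
    "emeasure \<mu> (topspace T) = m (topspace T)"
proof -
  let ?X = "topspace T"
  let ?O = "{U. openin T U}"
  let ?L = "lambda_system ?X (Pow ?X) outer_content"
  let ?\<mu> = "measure_of ?X ?O outer_content"
  interpret S: sigma_algebra ?X "Pow ?X" by (rule sigma_algebra_Pow)
  have L: "measure_space ?X ?L outer_content"
    by (rule S.caratheodory_lemma[OF outer_measure_space])
  then interpret L: sigma_algebra ?X ?L by (simp add: measure_space_def)
  have O: "?O \<subseteq> Pow ?X" by (auto dest: openin_subset)
  have "sigma_sets ?X ?O \<subseteq> ?L"
    by (rule L.sigma_sets_subset) (auto intro: open_in_lambda_system)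
  then have ms: "measure_space ?X (sigma_sets ?X ?O) outer_content"
    using measure_down[OF L sigma_algebra_sigma_sets[OF O]] by simp
  have sp: "space ?\<mu> = ?X" and se: "sets ?\<mu> = sigma_sets ?X ?O"
    using O by (auto simp: space_measure_of_conv)
  have em: "emeasure ?\<mu> B = outer_content B" if "B \<in> sigma_sets ?X ?O" for B
    by (rule emeasure_measure_of[OF refl O]) (use ms that in \<open>simp_all only: measure_space_def se\<close>)
  have openB: "U \<in> sets ?\<mu>" if "openin T U" for U using that se by auto
  have closedB: "C \<in> sets ?\<mu>" if "closedin T C" for C
  proof -
    have "space ?\<mu> - (?X - C) \<in> sets ?\<mu>" using that openB by (intro sets.compl_sets) auto
    then show ?thesis using closedin_subset[OF that] sp by (simp add: double_diff)
  qed
  have em_open: "emeasure ?\<mu> U = inner_content U" if "openin T U" for U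
    using em[of U] that outer_open[OF that] by auto
  have tot: "emeasure ?\<mu> ?X = m ?X" using em_open[of ?X] inner_topspace by simp
  have outer_reg: "emeasure ?\<mu> B = (INF U\<in>{U. openin T U \<and> B \<subseteq> U}. emeasure ?\<mu> U)" if "B \<in> sets ?\<mu>" for B
  proof -
    have "emeasure ?\<mu> B = outer_content B" using that em se by blast
    also have "\<dots> = (INF U\<in>{U. openin T U \<and> B \<subseteq> U}. emeasure ?\<mu> U)"
      unfolding outer_content_def[of B] by (rule INF_cong) (simp_all add: em_open)
    finally show ?thesis .
  qed
  have fin: "emeasure ?\<mu> B \<noteq> \<infinity>" if "B \<in> sets ?\<mu>" for B
    using emeasure_mono[of B ?X ?\<mu>] sets.sets_into_space[OF that] sp openB[of ?X] tot finite_total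
    by (auto simp: top_unique)
  have inner_reg: "emeasure ?\<mu> B = (SUP K\<in>{K. K \<in> sets ?\<mu> \<and> compactin T K \<and> K \<subseteq> B}. emeasure ?\<mu> K)"
    (is "_ = ?S") if B: "B \<in> sets ?\<mu>" for B
  proof (rule antisym)
    have BX: "B \<subseteq> ?X" using sets.sets_into_space[OF B] sp by simp
    have cB: "?X - B \<in> sets ?\<mu>" using sets.compl_sets[OF B] sp by simp
    have "m ?X \<le> ?S + emeasure ?\<mu> U" if U: "openin T U" "?X - B \<subseteq> U" for U
    proof -
      have K: "closedin T (?X - U)" using U by auto
      have "emeasure ?\<mu> ((?X - U) \<union> U) = emeasure ?\<mu> (?X - U) + emeasure ?\<mu> U"
        using K U openB closedB by (intro plus_emeasure[symmetric]) auto
      moreover have "(?X - U) \<union> U = ?X" using openin_subset[OF U(1)] by auto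
      moreover have "emeasure ?\<mu> (?X - U) \<le> ?S"
        using K U closedB closedin_compact_space[OF compact] by (intro SUP_upper) auto
      ultimately show ?thesis using tot by (simp add: add_right_mono)
    qed
    then have "m ?X - ?S \<le> (INF U\<in>{U. openin T U \<and> ?X - B \<subseteq> U}. emeasure ?\<mu> U)"
      using finite_total by (intro INF_greatest) (auto simp: ennreal_minus_le_iff)
    then have "m ?X - ?S \<le> emeasure ?\<mu> (?X - B)" by (simp only: outer_reg[OF cB])
    then have "m ?X \<le> ?S + emeasure ?\<mu> (?X - B)" by (simp add: ennreal_minus_le_iff)
    moreover have "m ?X = emeasure ?\<mu> B + emeasure ?\<mu> (?X - B)"
      using plus_emeasure[OF B cB] BX tot by (simp add: Un_absorb1)
    ultimately have "emeasure ?\<mu> (?X - B) + emeasure ?\<mu> B \<le> emeasure ?\<mu> (?X - B) + ?S" by (simp add: add.commute)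
    then show "emeasure ?\<mu> B \<le> ?S"
      using fin[OF cB] by (simp add: ennreal_add_left_cancel_le)
    show "?S \<le> emeasure ?\<mu> B"
      using B by (intro SUP_least emeasure_mono) simp_all
  qed
  have "regular_borel_measure T ?\<mu>"
    unfolding regular_borel_measure_def
  proof (intro conjI ballI allI impI)
    fix K assume "K \<in> sets ?\<mu> \<and> compactin T K"
    then show "emeasure ?\<mu> K < \<infinity>" using fin[of K] by (simp add: less_top)
  qed (fact sp se outer_reg inner_reg)+
  moreover have "m C \<le> emeasure ?\<mu> C" if "closedin T C" for C
    using em[of C] closedB[OF that] se le_outer_closed[OF that] by simp
  ultimately show ?thesis using tot that by blast
qed

end

section \<open>Integral representation of positive functionals\<close>

text \<open>
  The functional lives on all bounded functions, not only on the continuous ones, so it can be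
  evaluated at indicator functions. These values form a finitely additive set function.
\<close>

locale positive_functional =
  fixes T :: "'b topology" and L :: "('b \<Rightarrow> real) \<Rightarrow> real"
  assumes compact: "compact_space T"
    and Hausdorff: "Hausdorff_space T"
    and add: "\<And>g h. \<lbrakk>bounded (g ` topspace T); bounded (h ` topspace T)\<rbrakk>
                \<Longrightarrow> L (\<lambda>x. g x + h x) = L g + L h"
    and mono: "\<And>g h. \<lbrakk>bounded (g ` topspace T); bounded (h ` topspace T);
                  \<And>x. x \<in> topspace T \<Longrightarrow> g x \<le> h x\<rbrakk> \<Longrightarrow> L g \<le> L h"
begin

lemma zero: "L (\<lambda>x. 0) = 0"
  using add[of "\<lambda>x. 0" "\<lambda>x. 0"] by (auto simp: image_constant_conv)

lemma bounded_indicator: "bounded ((indicator A :: 'b \<Rightarrow> real) ` B)"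
  by (rule boundedI[of _ 1]) (auto simp: indicator_def)

lemma bounded_sum:
  fixes g :: "'i \<Rightarrow> 'b \<Rightarrow> real"
  assumes "\<And>i. i \<in> I \<Longrightarrow> bounded (g i ` B)"
  shows "bounded ((\<lambda>x. \<Sum>i\<in>I. g i x) ` B)"
  using assms by (induction I rule: infinite_finite_induct)
    (auto intro!: bounded_plus_comp simp: image_constant_conv)

lemma sum:
  assumes "finite I" "\<And>i. i \<in> I \<Longrightarrow> bounded (g i ` topspace T)"
  shows "L (\<lambda>x. \<Sum>i\<in>I. g i x) = (\<Sum>i\<in>I. L (g i))"
  using assms by (induction I rule: finite_induct) (simp_all add: zero add bounded_sum)

lemma nat_mult:
  assumes "bounded (g ` topspace T)"
  shows "L (\<lambda>x. real n * g x) = real n * L g"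
  using sum[of "{..<n}" "\<lambda>_. g"] assms by simp

lemma uminus:
  assumes "bounded (g ` topspace T)"
  shows "L (\<lambda>x. - g x) = - L g"
  using add[of g "\<lambda>x. - g x"] assms zero by (simp add: bounded_uminus image_image[symmetric])

definition weight :: "'b set \<Rightarrow> ennreal" where
  "weight A = ennreal (L (indicator A))"

lemma indicator_nonneg: "L (indicator A) \<ge> 0"
  using mono[of "\<lambda>x. 0" "indicator A"] by (simp add: zero bounded_indicator image_constant_conv)

sublocale additive_on_compact_Hausdorff T weight
proof
  fix A B :: "'b set" assume "A \<inter> B = {}"
  then have "(indicator (A \<union> B) :: 'b \<Rightarrow> real) = (\<lambda>x. indicator A x + indicator B x)"
    by (auto simp: indicator_def fun_eq_iff)
  then show "weight (A \<union> B) = weight A + weight B"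
    by (simp add: weight_def add bounded_indicator indicator_nonneg)
qed (simp_all add: compact Hausdorff weight_def)

lemma bounded_continuous:
  assumes "continuous_map T euclideanreal g"
  shows "bounded (g ` topspace T)"
  using image_compactin[of T "topspace T" euclideanreal g] assms compact compact_imp_bounded
  by (simp add: compact_space_def)

lemma continuous_measurable:
  assumes "regular_borel_measure T \<mu>" "continuous_map T euclideanreal g"
  shows "g \<in> borel_measurable \<mu>"
proof (rule borel_measurableI)
  fix S :: "real set" assume "open S"
  then have "openin T {x \<in> topspace T. g x \<in> S}"
    using assms(2) by (intro openin_continuous_map_preimage) auto
  moreover have "g -` S \<inter> space \<mu> = {x \<in> topspace T. g x \<in> S}"
    using assms(1) by (auto simp: regular_borel_measure_def)
  ultimately show "g -` S \<inter> space \<mu> \<in> sets \<mu>"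
    using assms(1) by (auto simp: regular_borel_measure_def)
qed

context
  fixes \<mu>
  assumes reg: "regular_borel_measure T \<mu>"
    and closed: "\<And>C. closedin T C \<Longrightarrow> weight C \<le> emeasure \<mu> C"
    and total: "emeasure \<mu> (topspace T) = weight (topspace T)"
begin

lemma space: "space \<mu> = topspace T"
  using reg by (simp add: regular_borel_measure_def)

interpretation finite_measure \<mu>
  by (rule finite_measureI) (metis finite_total total space infinity_ennreal_def order_less_irrefl)

lemma closed_sets: "closedin T C \<Longrightarrow> C \<in> sets \<mu>"
proof -
  assume C: "closedin T C"
  then have "topspace T - C \<in> sets \<mu>" using reg by (auto simp: regular_borel_measure_def)
  then have "space \<mu> - (topspace T - C) \<in> sets \<mu>" by (rule sets.compl_sets)
  then show ?thesis using C space by (metis closedin_def double_diff order_refl)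
qed

lemma L_closed: "closedin T C \<Longrightarrow> L (indicator C) \<le> measure \<mu> C"
  using closed[of C] by (simp add: weight_def emeasure_eq_measure)

lemma L_one: "L (\<lambda>x. 1) = measure \<mu> (topspace T)"
proof -
  have "L (\<lambda>x. 1) = L (indicator (topspace T))"
    by (intro antisym mono) (auto simp: bounded_indicator image_constant_conv)
  then show ?thesis
    using total indicator_nonneg by (simp add: weight_def emeasure_eq_measure)
qed

lemma integrable: "continuous_map T euclideanreal g \<Longrightarrow> integrable \<mu> g"
proof -
  assume g: "continuous_map T euclideanreal g"
  obtain B where "\<And>x. x \<in> topspace T \<Longrightarrow> norm (g x) \<le> B"
    using bounded_continuous[OF g] by (auto simp: bounded_iff)
  then show ?thesis
    using continuous_measurable[OF reg g] space by (intro integrable_const_bound[of _ B]) auto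
qed

text \<open>
  Approximate \<open>g\<close> from below by \<open>\<lfloor>g\<rfloor>\<close>, which is the sum of the indicators of the closed sets
  \<open>{g \<ge> k}\<close> for \<open>k \<ge> 1\<close>. On closed sets the measure dominates \<open>L\<close>, and the rounding error is at
  most \<open>1\<close>.
\<close>

lemma L_le_integral_add:
  assumes g: "continuous_map T euclideanreal g" and nonneg: "\<And>x. x \<in> topspace T \<Longrightarrow> 0 \<le> g x"
  shows "L g \<le> (\<integral>x. g x \<partial>\<mu>) + measure \<mu> (topspace T)"
proof -
  have bg: "bounded (g ` topspace T)" by (rule bounded_continuous[OF g])
  obtain b where b: "\<And>x. x \<in> topspace T \<Longrightarrow> norm (g x) \<le> b" using bg by (auto simp: bounded_iff)
  obtain n :: nat where n: "b \<le> real n" using real_arch_simple by blast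
  define C where "C k = {x \<in> topspace T. g x \<in> {real k..}}" for k :: nat
  define s where "s x = (\<Sum>k\<in>{1..n}. indicator (C k) x :: real)" for x :: 'b
  have C: "closedin T (C k)" for k
    unfolding C_def using g by (rule closedin_continuous_map_preimage) simp
  have s_eq: "s x = real (nat \<lfloor>g x\<rfloor>)" if x: "x \<in> topspace T" for x
  proof -
    have "g x \<le> real n" using b[OF x] n by auto
    then have "{k \<in> {1..n}. x \<in> C k} = {1..nat \<lfloor>g x\<rfloor>}"
      using x nonneg[OF x] by (auto simp: C_def le_nat_floor le_nat_iff le_floor_iff)
    then show ?thesis unfolding s_def by (simp add: indicator_def sum.If_cases Int_def)
  qed
  have s_le: "s x \<le> g x" and le_s: "g x \<le> s x + 1" if "x \<in> topspace T" for x
    using s_eq[OF that] nonneg[OF that] by (auto; linarith)+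
  have bs: "bounded (s ` topspace T)"
    unfolding s_def by (intro bounded_sum bounded_indicator)
  have b1: "bounded ((\<lambda>x::'b. 1::real) ` topspace T)" by (simp add: image_constant_conv)
  have "L g \<le> L (\<lambda>x. s x + 1)"
    using le_s by (intro mono bg bounded_plus_comp bs b1) auto
  also have "\<dots> = L s + L (\<lambda>x. 1)" by (rule add[OF bs b1])
  also have "L s = (\<Sum>k\<in>{1..n}. L (indicator (C k)))"
    unfolding s_def by (intro sum bounded_indicator) simp
  also have "\<dots> \<le> (\<Sum>k\<in>{1..n}. measure \<mu> (C k))"
    by (intro sum_mono L_closed C)
  also have "\<dots> = (\<integral>x. s x \<partial>\<mu>)"
    unfolding s_def using closed_sets[OF C] by (subst Bochner_Integration.integral_sum) (auto simp: emeasure_eq_measure)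
  also have "\<dots> \<le> (\<integral>x. g x \<partial>\<mu>)"
  proof (rule integral_mono)
    show "integrable \<mu> s"
      unfolding s_def using closed_sets[OF C] by (intro Bochner_Integration.integrable_sum) (auto simp: emeasure_eq_measure)
  qed (use g s_le space in \<open>auto intro: integrable\<close>)
  finally show ?thesis using L_one by simp
qed

text \<open>
  The additive error in the previous bound is removed by applying it to \<open>n \<cdot> (g + a)\<close> and letting
  \<open>n\<close> tend to infinity; the constant \<open>a\<close> makes the function nonnegative.
\<close>

lemma L_le_integral:
  assumes g: "continuous_map T euclideanreal g"
  shows "L g \<le> (\<integral>x. g x \<partial>\<mu>)"
proof -
  have bg: "bounded (g ` topspace T)" by (rule bounded_continuous[OF g])
  then obtain b where b: "\<And>x. x \<in> topspace T \<Longrightarrow> norm (g x) \<le> b" by (auto simp: bounded_iff)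
  obtain a :: nat where a: "b \<le> real a" using real_arch_simple by blast
  let ?M = "measure \<mu> (topspace T)"
  have ba: "bounded ((\<lambda>x::'b. real a) ` topspace T)" by (simp add: image_constant_conv)
  have La: "L (\<lambda>x. real a) = real a * ?M"
    using nat_mult[of "\<lambda>x. 1" a] L_one by (simp add: image_constant_conv)
  have "real n * (L g - (\<integral>x. g x \<partial>\<mu>)) \<le> ?M" for n :: nat
  proof -
    have "real n * (L g + real a * ?M) = L (\<lambda>x. real n * (g x + real a))"
      using nat_mult[OF bounded_plus_comp[OF bg ba]] add[OF bg ba] La by simp
    also have "\<dots> \<le> (\<integral>x. real n * (g x + real a) \<partial>\<mu>) + ?M"
    proof (rule L_le_integral_add)
      show "0 \<le> real n * (g x + real a)" if "x \<in> topspace T" for x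
        using b[OF that] a by (intro mult_nonneg_nonneg) auto
    qed (intro continuous_intros g)
    also have "\<dots> = real n * ((\<integral>x. g x \<partial>\<mu>) + real a * ?M) + ?M"
      using integrable[OF g] space by (simp add: algebra_simps)
    finally show ?thesis by (simp add: algebra_simps)
  qed
  then show ?thesis
    using reals_Archimedean3[of "L g - (\<integral>x. g x \<partial>\<mu>)"]
    by (metis diff_gt_0_iff_gt linorder_not_le)
qed

lemma L_eq_integral:
  assumes g: "continuous_map T euclideanreal g"
  shows "L g = (\<integral>x. g x \<partial>\<mu>)"
proof (rule antisym[OF L_le_integral[OF g]])
  have "L (\<lambda>x. - g x) \<le> (\<integral>x. - g x \<partial>\<mu>)"
    by (intro L_le_integral continuous_intros g)
  then show "(\<integral>x. g x \<partial>\<mu>) \<le> L g"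
    using uminus[OF bounded_continuous[OF g]] by simp
qed

end

text \<open>
  An existence form of the Riesz representation theorem. The inequality
  \<open>L g \<le> \<integral> g d\<mu>\<close> for all continuous \<open>g\<close> becomes an equality upon replacing \<open>g\<close> by \<open>-g\<close>.
\<close>

theorem representing_measure:
  obtains \<mu> where "regular_borel_measure T \<mu>"
    "\<And>g. continuous_map T euclideanreal g \<Longrightarrow> integrable \<mu> g \<and> L g = (\<integral>x. g x \<partial>\<mu>)"
  using regular_measure integrable L_eq_integral by metis

end

section \<open>Compactness of the normalized functionals\<close>

lemma functional_nat_multiple:
  assumes "functional f"
  shows "f (nat_multiple n x) = real n * f x"
  using assms by (induction n) (simp_all add: nat_multiple_def functional_def algebra_simps)

lemma functional_scale: "functional f \<Longrightarrow> 0 \<le> a \<Longrightarrow> functional (\<lambda>x. a * f x)"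
  by (auto simp: functional_def mono_def algebra_simps intro: mult_left_mono)

lemma functional_bound:
  fixes f :: "'a::ordered_comm_monoid_add \<Rightarrow> real"
  assumes "functional f"
    and "x + nat_multiple n gm \<le> nat_multiple n gp"
    and "nat_multiple n gm \<le> nat_multiple n gp + x"
  shows "\<bar>f x\<bar> \<le> real n * (f gp - f gm)"
proof -
  have mono: "f u \<le> f v" if "u \<le> v" for u v using assms(1) that by (auto simp: functional_def mono_def)
  have "f (u + v) = f u + f v" for u v using assms(1) by (simp add: functional_def)
  then show ?thesis
    using mono[OF assms(2)] mono[OF assms(3)] by (simp add: functional_nat_multiple[OF assms(1)] algebra_simps)
qed

locale monoid_with_generating_pair =
  fixes gp gm :: "'a::ordered_comm_monoid_add"
  assumes pair: "generating_pair gp gm"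
begin

abbreviation K where "K \<equiv> normalized_functionals gp gm"
abbreviation T where "T \<equiv> weak_star_topology gp gm"

text \<open>
  The generating pair bounds each element with a constant independent of the functional; this
  uniformity is what makes the set of normalized functionals compact.
\<close>

lemma functional_bounded:
  "\<exists>n::nat. \<forall>f. functional f \<longrightarrow> \<bar>f x\<bar> \<le> real n * (f gp - f gm)"
  using pair functional_bound unfolding generating_pair_def by metis

lemma functional_pair_le: "functional f \<Longrightarrow> f gm \<le> f gp"
  using pair by (auto simp: generating_pair_def functional_def mono_def)

lemma functional_eq_0: "functional f \<Longrightarrow> f gp = f gm \<Longrightarrow> f x = 0"
  using functional_bounded[of x] by fastforce

lemma normalize: "functional f \<Longrightarrow> f gm < f gp \<Longrightarrow> (\<lambda>x. 1 / (f gp - f gm) * f x) \<in> K"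
  unfolding normalized_functionals_def
  by (auto intro!: functional_scale simp del: times_divide_eq_left) (simp add: field_simps)

lemma topspace_T: "topspace T = K"
  unfolding weak_star_topology_def by auto

lemma openin_evaluation: "open U \<Longrightarrow> openin T {f \<in> K. f x \<in> U}"
  unfolding weak_star_topology_def by (rule topology_generated_by_Basis) auto

lemma continuous_evaluation: "continuous_map T euclideanreal (\<lambda>f. f x)"
  using openin_evaluation by (auto simp: continuous_map_def topspace_T)

lemma Hausdorff_T: "Hausdorff_space T"
  unfolding Hausdorff_space_def topspace_T
proof (intro allI impI)
  fix f g :: "'a \<Rightarrow> real" assume fg: "f \<in> K \<and> g \<in> K \<and> f \<noteq> g"
  then obtain x where "f x \<noteq> g x" by auto
  then obtain U V where UV: "open U" "open V" "f x \<in> U" "g x \<in> V" "U \<inter> V = {}"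
    using hausdorff[of "f x" "g x"] by blast
  then show "\<exists>U V. openin T U \<and> openin T V \<and> f \<in> U \<and> g \<in> V \<and> disjnt U V"
    using fg openin_evaluation[of U x] openin_evaluation[of V x]
    by (intro exI[of _ "{f \<in> K. f x \<in> U}"] exI[of _ "{f \<in> K. f x \<in> V}"]) (auto simp: disjnt_def)
qed

text \<open>
  The normalized functionals form a closed subset of a product of compact intervals, to which
  Tychonoff's theorem applies.
\<close>

lemma compact_K: "compact K"
proof -
  obtain n :: "'a \<Rightarrow> nat" where n: "\<And>x f. functional f \<Longrightarrow> \<bar>f x\<bar> \<le> real (n x) * (f gp - f gm)"
    using functional_bounded by metis
  let ?B = "PiE UNIV (\<lambda>x. {- real (n x)..real (n x)})"
  have "compactin (product_topology (\<lambda>_. euclideanreal) UNIV) ?B"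
    by (simp add: compactin_PiE)
  then have B: "compact ?B" by (simp add: euclidean_product_topology)
  have le: "closed {f :: 'a \<Rightarrow> real. x \<le> y \<longrightarrow> f x \<le> f y}" for x y
    by (cases "x \<le> y") (auto intro!: closed_Collect_le continuous_on_product_coordinates)
  have "closed {f :: 'a \<Rightarrow> real. (\<forall>x y. x \<le> y \<longrightarrow> f x \<le> f y)}"
    "closed {f :: 'a \<Rightarrow> real. \<forall>x y. f (x + y) = f x + f y}"
    "closed {f :: 'a \<Rightarrow> real. f 0 = 0}"
    "closed {f :: 'a \<Rightarrow> real. f gp = f gm + 1}"
    by (intro closed_Collect_all le closed_Collect_eq continuous_intros continuous_on_product_coordinates)+
  then have "closed ({f :: 'a \<Rightarrow> real. (\<forall>x y. x \<le> y \<longrightarrow> f x \<le> f y)} \<inter>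
    {f. \<forall>x y. f (x + y) = f x + f y} \<inter> {f. f 0 = 0} \<inter> {f. f gp = f gm + 1})" (is "closed ?C")
    by (intro closed_Int)
  moreover have "K = ?B \<inter> ?C"
  proof
    show "K \<subseteq> ?B \<inter> ?C"
    proof
      fix f assume f: "f \<in> K"
      then have "\<bar>f x\<bar> \<le> real (n x)" for x using n[of f x] by (simp add: normalized_functionals_def)
      then have "f \<in> ?B" by (simp add: PiE_UNIV_domain abs_le_iff minus_le_iff)
      moreover have "f \<in> ?C" using f by (simp add: normalized_functionals_def functional_def mono_def)
      ultimately show "f \<in> ?B \<inter> ?C" by simp
    qed
    show "?B \<inter> ?C \<subseteq> K"
      by (rule subsetI) (simp add: normalized_functionals_def functional_def mono_def)
  qed
  ultimately show ?thesis using compact_Int_closed[OF B] by simp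
qed

text \<open>
  The weak-* topology has no more open sets than the subspace topology inherited from the product.
\<close>

lemma compact_T: "compact_space T"
proof -
  have "continuous_map (top_of_set K) T (\<lambda>f. f)"
    unfolding weak_star_topology_def
  proof (rule continuous_on_generated_topo)
    fix W assume "W \<in> {{f \<in> K. f x \<in> U} |x U. open U}"
    then obtain x and U :: "real set" where W: "W = {f \<in> K. f x \<in> U}" "open U" by auto
    have "continuous_on K (\<lambda>f. f x)"
      by (rule continuous_on_subset[OF continuous_on_product_coordinates subset_UNIV])
    then have "openin (top_of_set K) (K \<inter> (\<lambda>f. f x) -` U)"
      using W(2) by (rule continuous_openin_preimage_gen)
    moreover have "(\<lambda>f. f) -` W \<inter> topspace (top_of_set K) = K \<inter> (\<lambda>f. f x) -` U"
      using W(1) by auto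
    ultimately show "openin (top_of_set K) ((\<lambda>f. f) -` W \<inter> topspace (top_of_set K))" by simp
  qed auto
  then have "compactin T ((\<lambda>f. f) ` K)"
    using compact_K by (intro image_compactin) (auto simp: compactin_subtopology)
  then show ?thesis by (simp add: compact_space_def topspace_T)
qed

section \<open>Faces and extremal functionals\<close>

text \<open>
  The closed extreme subsets of the compact set of normalized functionals.
\<close>

definition face :: "('a \<Rightarrow> real) set \<Rightarrow> bool" where
  "face F \<longleftrightarrow> closedin T F \<and> F \<noteq> {} \<and>
     (\<forall>f\<in>K. \<forall>g\<in>K. \<forall>s. 0 < s \<and> s < 1 \<and> (\<lambda>x. s * f x + (1 - s) * g x) \<in> F \<longrightarrow> f \<in> F \<and> g \<in> F)"

lemma face_subset: "face F \<Longrightarrow> F \<subseteq> K"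
  unfolding face_def using closedin_subset topspace_T by blast

lemma faceD:
  assumes "face F" "f \<in> K" "g \<in> K" "0 < s" "s < 1" "(\<lambda>x. s * f x + (1 - s) * g x) \<in> F"
  shows "f \<in> F" "g \<in> F"
  using assms unfolding face_def by blast+

definition maximizers :: "'a \<Rightarrow> 'a \<Rightarrow> ('a \<Rightarrow> real) set \<Rightarrow> ('a \<Rightarrow> real) set" where
  "maximizers x y F = {h \<in> F. \<forall>g\<in>F. g x - g y \<le> h x - h y}"

lemma face_maximizers:
  assumes F: "face F"
  shows "face (maximizers x y F)"
proof -
  have cont: "continuous_map T euclideanreal (\<lambda>h. h x - h y)"
    by (intro continuous_intros continuous_evaluation)
  have "compactin T F" using F compact_T by (auto simp: face_def intro: closedin_compact_space)
  then have "compact ((\<lambda>h. h x - h y) ` F)" using image_compactin[OF _ cont] by simp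
  then obtain h0 where h0: "h0 \<in> F" "\<And>g. g \<in> F \<Longrightarrow> g x - g y \<le> h0 x - h0 y"
    using compact_attains_sup[of "(\<lambda>h. h x - h y) ` F"] F by (auto simp: face_def)
  have "maximizers x y F = F \<inter> {h \<in> topspace T. h x - h y \<in> {h0 x - h0 y..}}"
    using h0 face_subset[OF F] unfolding maximizers_def topspace_T by fastforce
  moreover have "closedin T {h \<in> topspace T. h x - h y \<in> {h0 x - h0 y..}}"
    using cont by (rule closedin_continuous_map_preimage) simp
  ultimately have "closedin T (maximizers x y F)" using F by (simp add: face_def closedin_Int)
  moreover have "h0 \<in> maximizers x y F" using h0 by (simp add: maximizers_def)
  moreover have "f \<in> maximizers x y F \<and> g \<in> maximizers x y F"
    if fg: "f \<in> K" "g \<in> K" and s: "0 < s" "s < 1"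
      and M: "(\<lambda>z. s * f z + (1 - s) * g z) \<in> maximizers x y F" for f g s
  proof -
    have "f \<in> F" "g \<in> F" using faceD[OF F fg s] M by (auto simp: maximizers_def)
    define a b c where "a = f x - f y" and "b = g x - g y" and "c = h0 x - h0 y"
    have "a \<le> c" "b \<le> c" using h0 \<open>f \<in> F\<close> \<open>g \<in> F\<close> by (auto simp: a_def b_def c_def)
    have "c \<le> s * a + (1 - s) * b"
      using M h0(1) by (auto simp: maximizers_def a_def b_def c_def algebra_simps)
    then have "0 \<le> s * (a - c) + (1 - s) * (b - c)" by (simp add: algebra_simps)
    moreover have "s * (a - c) \<le> 0" "(1 - s) * (b - c) \<le> 0"
      using \<open>a \<le> c\<close> \<open>b \<le> c\<close> s by (auto intro: mult_nonneg_nonpos)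
    ultimately have "s * (a - c) = 0" "(1 - s) * (b - c) = 0" by linarith+
    then have "a = c" "b = c" using s by auto
    then show ?thesis
      using h0 \<open>f \<in> F\<close> \<open>g \<in> F\<close> by (auto simp: maximizers_def a_def b_def c_def)
  qed
  ultimately show ?thesis unfolding face_def by blast
qed

lemma face_Inter:
  assumes ne: "\<F> \<noteq> {}" and face: "\<And>F. F \<in> \<F> \<Longrightarrow> face F"
    and chain: "\<And>F G. F \<in> \<F> \<Longrightarrow> G \<in> \<F> \<Longrightarrow> F \<subseteq> G \<or> G \<subseteq> F"
  shows "face (\<Inter>\<F>)"
proof -
  have closed: "closedin T F" if "F \<in> \<F>" for F using face[OF that] by (simp add: face_def)
  have "\<Inter>\<G> \<in> \<F>" if "finite \<G>" "\<G> \<noteq> {}" "\<G> \<subseteq> \<F>" for \<G>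
    using that
  proof (induction \<G> rule: finite_ne_induct)
    case (insert F \<G>)
    then have "F \<in> \<F>" "\<Inter>\<G> \<in> \<F>" by simp_all
    then show ?case using chain[of F "\<Inter>\<G>"] by (auto simp: Int_absorb1 Int_absorb2)
  qed simp
  then have "\<Inter>\<G> \<noteq> {}" if "finite \<G>" "\<G> \<subseteq> \<F>" for \<G>
    using that face by (cases "\<G> = {}") (simp, metis face_def)
  then have "\<Inter>\<F> \<noteq> {}" using compact_T[unfolded compact_space_fip, rule_format, of \<F>] closed by simp
  moreover have "closedin T (\<Inter>\<F>)" using closed ne by (intro closedin_Inter)
  moreover have "f \<in> \<Inter>\<F> \<and> g \<in> \<Inter>\<F>"
    if fg: "f \<in> K" "g \<in> K" and s: "0 < s" "s < 1"
      and M: "(\<lambda>z. s * f z + (1 - s) * g z) \<in> \<Inter>\<F>" for f g s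
  proof -
    have "f \<in> F \<and> g \<in> F" if "F \<in> \<F>" for F
      using faceD[OF face[OF that] fg s InterD[OF M that]] by blast
    then show ?thesis by blast
  qed
  ultimately show ?thesis unfolding face_def by blast
qed

text \<open>
  A decomposition \<open>h = f + (h - f)\<close> into functionals, with each part rescaled to be normalized,
  exhibits \<open>h\<close> as a proper convex combination, unless one part vanishes.
\<close>

lemma singleton_face_extremal:
  assumes "face {h}"
  shows "extremal h"
proof -
  have hK: "h \<in> K" using face_subset[OF assms] by simp
  then have h: "functional h" "h gp = h gm + 1" by (auto simp: normalized_functionals_def)
  have "\<exists>c\<ge>0. \<forall>x. f x = c * h x" if f: "functional f" "functional (\<lambda>x. h x - f x)" for f
  proof -
    define s where "s = f gp - f gm"
    have s: "0 \<le> s" "s \<le> 1"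
      using functional_pair_le[OF f(1)] functional_pair_le[OF f(2)] h(2) by (auto simp: s_def)
    consider "s = 0" | "s = 1" | "0 < s" "s < 1" using s by linarith
    then have "f x = s * h x" for x
    proof cases
      case 1
      then have "f x = 0" by (intro functional_eq_0 f) (simp add: s_def)
      then show ?thesis using 1 by simp
    next
      case 2
      then have "h x - f x = 0" using h(2) by (intro functional_eq_0[OF f(2)]) (simp add: s_def)
      then show ?thesis using 2 by simp
    next
      case 3
      let ?f = "\<lambda>x. 1 / s * f x" and ?g = "\<lambda>x. 1 / (1 - s) * (h x - f x)"
      have "f gm < f gp" using 3 by (simp add: s_def)
      then have fK: "?f \<in> K" unfolding s_def by (rule normalize[OF f(1)])
      have eq: "h gp - f gp - (h gm - f gm) = 1 - s" using h(2) by (simp add: s_def)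
      then have "h gm - f gm < h gp - f gp" using 3 by linarith
      then have gK: "?g \<in> K" unfolding eq[symmetric] by (rule normalize[OF f(2)])
      have "(\<lambda>x. s * ?f x + (1 - s) * ?g x) \<in> {h}"
        using 3 by (simp add: fun_eq_iff)
      then have "?f \<in> {h}" by (rule faceD(1)[OF assms fK gK 3])
      then have "?f x = h x" by (auto dest: fun_cong[of _ _ x])
      then show ?thesis using 3 by (simp add: field_simps)
    qed
    then show ?thesis using s(1) by (intro exI[of _ s]) simp
  qed
  then show ?thesis using h(1) by (simp add: extremal_def functional_ge_def)
qed

text \<open>
  Bauer's maximum principle. The maximizers form a face; a minimal face inside it, obtained from
  Zorn's lemma and compactness, cannot be separated by any evaluation and hence is a single point.
\<close>

lemma extremal_maximizer:
  assumes "K \<noteq> {}"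
  obtains h where "h \<in> K" "extremal h" "\<And>f. f \<in> K \<Longrightarrow> f x - f y \<le> h x - h y"
proof -
  have K: "face K" using assms closedin_topspace[of T] by (simp add: face_def topspace_T)
  let ?\<A> = "{F. face F \<and> F \<subseteq> maximizers x y K}"
  have "\<exists>F\<in>?\<A>. \<forall>G\<in>?\<A>. G \<subseteq> F \<longrightarrow> G = F"
  proof (rule predicate_Zorn)
    show "partial_order_on ?\<A> (relation_of (\<lambda>F G. G \<subseteq> F) ?\<A>)"
      by (rule partial_order_on_relation_ofI) auto
    fix C assume C: "C \<in> Chains (relation_of (\<lambda>F G. G \<subseteq> F) ?\<A>)"
    show "\<exists>U\<in>?\<A>. \<forall>F\<in>C. U \<subseteq> F"
    proof (cases "C = {}")
      case True
      then show ?thesis using face_maximizers[OF K] by auto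
    next
      case False
      have CA: "\<And>F. F \<in> C \<Longrightarrow> F \<in> ?\<A>" and "\<And>F G. F \<in> C \<Longrightarrow> G \<in> C \<Longrightarrow> F \<subseteq> G \<or> G \<subseteq> F"
        using C unfolding Chains_def relation_of_def by blast+
      then have "face (\<Inter>C)" using False by (intro face_Inter) simp_all
      moreover have "\<Inter>C \<subseteq> maximizers x y K" using CA False by blast
      ultimately show ?thesis by (intro bexI[of _ "\<Inter>C"]) auto
    qed
  qed
  then obtain F where F: "face F" "F \<subseteq> maximizers x y K"
    and least: "\<forall>G\<in>?\<A>. G \<subseteq> F \<longrightarrow> G = F" by (elim bexE CollectE conjE)
  have min: "G = F" if "face G" "G \<subseteq> F" for G
    using least that F(2) by (simp add: subset_trans[of G F])
  have "F \<noteq> {}" using F(1) by (simp add: face_def)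
  then obtain h where h: "h \<in> F" by blast
  have "g = h" if g: "g \<in> F" for g
  proof
    fix z
    \<comment> \<open>As functionals vanish at 0, comparing \<open>h z - h 0\<close> amounts to comparing \<open>h z\<close>.\<close>
    have "maximizers z 0 F = F"
      by (rule min[OF face_maximizers[OF F(1)]]) (simp add: maximizers_def)
    then have "g \<in> maximizers z 0 F" "h \<in> maximizers z 0 F" using g h by simp_all
    then have "g z - g 0 \<le> h z - h 0" "h z - h 0 \<le> g z - g 0"
      using g h by (simp_all add: maximizers_def)
    moreover have "g \<in> K" "h \<in> K" using g h face_subset[OF F(1)] by blast+
    then have "g 0 = 0" "h 0 = 0" by (simp_all add: normalized_functionals_def functional_def)
    ultimately show "g z = h z" by simp
  qed
  then have "F = {h}" using h by blast
  then have "extremal h" using F(1) singleton_face_extremal by simp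
  moreover have "h \<in> K" and "\<And>f. f \<in> K \<Longrightarrow> f x - f y \<le> h x - h y"
    using h F(2) by (auto simp: maximizers_def)
  ultimately show ?thesis using that by blast
qed

section \<open>Representation on the closure of the extremal functionals\<close>

lemma ex_closure_subset: "ex_closure gp gm \<subseteq> K"
  using closure_of_subset_topspace[of T] by (simp add: ex_closure_def topspace_T)

lemma topspace_ex_closure: "topspace (ex_closure_topology gp gm) = ex_closure gp gm"
  using ex_closure_subset by (auto simp: ex_closure_topology_def topspace_T)

lemma compact_ex_closure: "compact_space (ex_closure_topology gp gm)"
  unfolding ex_closure_topology_def ex_closure_def
  by (intro compact_space_subtopology closedin_compact_space compact_T closedin_closure_of)

lemma Hausdorff_ex_closure: "Hausdorff_space (ex_closure_topology gp gm)"
  unfolding ex_closure_topology_def by (intro Hausdorff_space_subtopology Hausdorff_T)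

lemma continuous_evaluation_ex_closure:
  "continuous_map (ex_closure_topology gp gm) euclideanreal (\<lambda>h. h x)"
  unfolding ex_closure_topology_def
  by (intro continuous_map_from_subtopology continuous_evaluation)

lemma bounded_evaluation: "bounded ((\<lambda>h. h x) ` ex_closure gp gm)"
proof -
  obtain n :: nat where n: "\<forall>f. functional f \<longrightarrow> \<bar>f x\<bar> \<le> real n * (f gp - f gm)"
    using functional_bounded by blast
  show ?thesis
  proof (rule boundedI)
    fix r assume "r \<in> (\<lambda>h. h x) ` ex_closure gp gm"
    then obtain h where h: "h \<in> K" "r = h x" using ex_closure_subset by blast
    then have "functional h" "h gp = h gm + 1" by (simp_all add: normalized_functionals_def)
    then show "norm r \<le> real n" using n h(2) by force
  qed
qed

text \<open>
  An inequality valid on all normalized extremal functionals is valid, by the maximum principle,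
  on all normalized functionals, and therefore on every functional after rescaling. The vanishing
  functional has no normalization and is treated separately.
\<close>

lemma functional_dominated:
  assumes f: "functional f" and le: "\<And>h. h \<in> ex_closure gp gm \<Longrightarrow> h x \<le> h y + t"
  shows "f x \<le> f y + t * (f gp - f gm)"
proof (cases "f gp = f gm")
  case True
  then have "f z = 0" for z by (rule functional_eq_0[OF f])
  then show ?thesis by simp
next
  case False
  define c where "c = f gp - f gm"
  have c: "f gm < f gp" "0 < c" using False functional_pair_le[OF f] by (simp_all add: c_def)
  have fK: "(\<lambda>z. 1 / c * f z) \<in> K" unfolding c_def by (rule normalize[OF f c(1)])
  then have "K \<noteq> {}" by blast
  then obtain h where h: "h \<in> K" "extremal h" and max: "\<And>g. g \<in> K \<Longrightarrow> g x - g y \<le> h x - h y"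
    using extremal_maximizer[of x y] by blast
  have "{g \<in> K. extremal g} \<subseteq> ex_closure gp gm"
    unfolding ex_closure_def by (rule closure_of_subset) (simp add: topspace_T)
  then have "h \<in> ex_closure gp gm" using h by blast
  then have "h x - h y \<le> t" using le[of h] by simp
  then have "1 / c * f x - 1 / c * f y \<le> t" using max[OF fK] by linarith
  then have "f x \<le> f y + t * c" using c(2) by (simp add: field_simps)
  then show ?thesis by (simp only: c_def)
qed

lemma dominated_functional_ex_closure:
  assumes f: "functional f"
  shows "dominated_functional (ex_closure gp gm) f (f gp - f gm)"
proof
  fix h x y assume "h \<in> ex_closure gp gm"
  then have "functional h" using ex_closure_subset by (auto simp: normalized_functionals_def)
  then show "h (x + y) = h x + h y" and "h 0 = 0" by (simp_all add: functional_def)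
qed (use f in \<open>simp_all add: functional_def bounded_evaluation functional_dominated[OF f]\<close>)

end

theorem corollary7p9:
  fixes gp gm :: "'a::ordered_comm_monoid_add" and f :: "'a \<Rightarrow> real"
  assumes "generating_pair gp gm"
    and "functional f"
  shows "\<exists>\<mu>. regular_borel_measure (ex_closure_topology gp gm) \<mu> \<and>
     (\<forall>x. integrable \<mu> (\<lambda>h. h x) \<and> f x = (\<integral>h. h x \<partial>\<mu>))"
proof -
  interpret monoid_with_generating_pair gp gm
    using assms(1) by unfold_locales
  interpret dominated_functional "ex_closure gp gm" f "f gp - f gm"
    by (rule dominated_functional_ex_closure[OF assms(2)])
  obtain L where L:
    "\<And>g g'. bounded (g ` ex_closure gp gm) \<Longrightarrow> bounded (g' ` ex_closure gp gm)
      \<Longrightarrow> L (\<lambda>h. g h + g' h) = L g + L g'"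
    "\<And>g g'. bounded (g ` ex_closure gp gm) \<Longrightarrow> bounded (g' ` ex_closure gp gm)
      \<Longrightarrow> (\<And>h. h \<in> ex_closure gp gm \<Longrightarrow> g h \<le> g' h) \<Longrightarrow> L g \<le> L g'"
    "\<And>x. L (\<lambda>h. h x) = f x"
    using positive_extension by blast
  interpret positive_functional "ex_closure_topology gp gm" L
    by (rule positive_functional.intro)
      (simp_all add: compact_ex_closure Hausdorff_ex_closure topspace_ex_closure L(1,2))
  obtain \<mu> where reg: "regular_borel_measure (ex_closure_topology gp gm) \<mu>"
    and int: "\<And>g. continuous_map (ex_closure_topology gp gm) euclideanreal g
      \<Longrightarrow> integrable \<mu> g \<and> L g = (\<integral>h. g h \<partial>\<mu>)"
    using representing_measure by blast
  have "integrable \<mu> (\<lambda>h. h x) \<and> f x = (\<integral>h. h x \<partial>\<mu>)" for x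
    using int[OF continuous_evaluation_ex_closure[of x]] L(3)[of x] by simp
  then show ?thesis using reg by blast
qed

end
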